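(* For every Boolean function $f\colon\{0,1\}^n\to\{0,1\}$, $D(f)\le 4\,\mathrm{sdeg}(f)^2\,\mathrm{rdeg}(f)^2$.
   Context: A rational representation of $f$ is a pair of multilinear $p,q\in\mathbb{R}[X_1,\dots,X_n]$ with $q(x)\neq 0$ and $p(x)/q(x)=f(x)$ for all $x\in\{0,1\}^n$; $\mathrm{rdeg}(f)$ is the minimum of $\max(\deg p,\deg q)$ over rational representations. A sign representation of $f$ is a multilinear real polynomial $p$ with $p(x)\neq0$ for all $x\in\{0,1\}^n$ and $p(x)<0$ iff $f(x)=1$; $\mathrm{sdeg}(f)$ is the minimum degree of a sign representation. $D(f)$ is the minimum depth of a deterministic decision tree that queries bits of $x$ and outputs $f(x)$ exactly for every $x\in\{0,1\}^n$. *)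

theory Defs
  imports Complex_Main "HOL-Library.Poly_Mapping" "HOL-Library.FuncSet"
begin

text \<open>
  The cube \<open>{0,1}\<^sup>n\<close> consists of the Boolean functions on \<open>{..<n}\<close>, with \<open>True\<close> for 1 and \<open>False\<close> for 0;
  a Boolean function of \<open>n\<close> bits is a total function of which only the values on the cube matter.
  A polynomial in \<open>X\<^sub>0, X\<^sub>1, \<dots>\<close> maps exponent vectors to coefficients.
\<close>

definition cube :: "nat \<Rightarrow> (nat \<Rightarrow> bool) set" where
  "cube n = ({..<n} \<rightarrow>\<^sub>E UNIV)"

type_synonym monom = "nat \<Rightarrow>\<^sub>0 nat"
type_synonym real_mpoly = "monom \<Rightarrow>\<^sub>0 real"

definition monom_value :: "monom \<Rightarrow> (nat \<Rightarrow> real) \<Rightarrow> real" where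
  "monom_value m x = (\<Prod>i\<in>Poly_Mapping.keys m. x i ^ Poly_Mapping.lookup m i)"

definition poly_value :: "real_mpoly \<Rightarrow> (nat \<Rightarrow> real) \<Rightarrow> real" where
  "poly_value p x = (\<Sum>m\<in>Poly_Mapping.keys p. Poly_Mapping.lookup p m * monom_value m x)"

definition cube_value :: "real_mpoly \<Rightarrow> (nat \<Rightarrow> bool) \<Rightarrow> real" where
  "cube_value p x = poly_value p (\<lambda>i. of_bool (x i))"

definition monom_degree :: "monom \<Rightarrow> nat" where
  "monom_degree m = (\<Sum>i\<in>Poly_Mapping.keys m. Poly_Mapping.lookup m i)"

text \<open>The zero polynomial gets degree 0.\<close>

definition total_degree :: "real_mpoly \<Rightarrow> nat" where
  "total_degree p = Max (insert 0 (monom_degree ` Poly_Mapping.keys p))"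

definition multilinear :: "nat \<Rightarrow> real_mpoly \<Rightarrow> bool" where
  "multilinear n p \<longleftrightarrow> (\<forall>m\<in>Poly_Mapping.keys p. Poly_Mapping.keys m \<subseteq> {..<n} \<and> (\<forall>i. Poly_Mapping.lookup m i \<le> 1))"

definition rational_rep ::
    "nat \<Rightarrow> ((nat \<Rightarrow> bool) \<Rightarrow> bool) \<Rightarrow> real_mpoly \<Rightarrow> real_mpoly \<Rightarrow> bool" where
  "rational_rep n f p q \<longleftrightarrow> multilinear n p \<and> multilinear n q \<and>
     (\<forall>x\<in>cube n. cube_value q x \<noteq> 0 \<and> cube_value p x / cube_value q x = of_bool (f x))"

definition rdeg :: "nat \<Rightarrow> ((nat \<Rightarrow> bool) \<Rightarrow> bool) \<Rightarrow> nat" where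
  "rdeg n f = (LEAST d. \<exists>p q. rational_rep n f p q \<and> d = max (total_degree p) (total_degree q))"

definition sign_rep :: "nat \<Rightarrow> ((nat \<Rightarrow> bool) \<Rightarrow> bool) \<Rightarrow> real_mpoly \<Rightarrow> bool" where
  "sign_rep n f p \<longleftrightarrow> multilinear n p \<and>
     (\<forall>x\<in>cube n. cube_value p x \<noteq> 0 \<and> (cube_value p x < 0 \<longleftrightarrow> f x))"

definition sdeg :: "nat \<Rightarrow> ((nat \<Rightarrow> bool) \<Rightarrow> bool) \<Rightarrow> nat" where
  "sdeg n f = (LEAST d. \<exists>p. sign_rep n f p \<and> d = total_degree p)"

text \<open>\<open>Query i s t\<close> reads bit \<open>i\<close> and continues with \<open>s\<close> if it is 0 and with \<open>t\<close> if it is 1.\<close>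

datatype dtree = Output bool | Query nat dtree dtree

primrec run :: "dtree \<Rightarrow> (nat \<Rightarrow> bool) \<Rightarrow> bool" where
  "run (Output b) x = b"
| "run (Query i s t) x = (if x i then run t x else run s x)"

primrec depth :: "dtree \<Rightarrow> nat" where
  "depth (Output b) = 0"
| "depth (Query i s t) = Suc (max (depth s) (depth t))"

primrec queries :: "dtree \<Rightarrow> nat set" where
  "queries (Output b) = {}"
| "queries (Query i s t) = insert i (queries s \<union> queries t)"

definition computes :: "nat \<Rightarrow> dtree \<Rightarrow> ((nat \<Rightarrow> bool) \<Rightarrow> bool) \<Rightarrow> bool" where
  "computes n T f \<longleftrightarrow> queries T \<subseteq> {..<n} \<and> (\<forall>x\<in>cube n. run T x = f x)"

definition dt_complexity :: "nat \<Rightarrow> ((nat \<Rightarrow> bool) \<Rightarrow> bool) \<Rightarrow> nat" where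
  "dt_complexity n f = (LEAST d. \<exists>T. computes n T f \<and> d = depth T)"

end

theory Submission
  imports Defs "HOL-Computational_Algebra.Polynomial"
begin

text \<open>
  If \<open>p / q\<close> represents \<open>f\<close>, then \<open>p\<close> is nonzero exactly where \<open>f\<close> is 1 and \<open>q - p\<close> exactly where \<open>f\<close> is 0.
  Let the sign representation \<open>t\<close>, of degree \<open>s\<close>, have its largest absolute value at \<open>x\<close>, and say \<open>f x = 0\<close>.
  The variables of a monomial of top degree in \<open>p\<close> can be reset, whatever the other variables are, so
  that \<open>p\<close> becomes nonzero; hence each such monomial contains a block whose flip at \<open>x\<close> changes the
  sign of \<open>t\<close>. Given \<open>k\<close> disjoint blocks, flip each independently with probability \<open>\<theta>\<close>: the expectation
  of \<open>t\<close> is a polynomial in \<open>\<theta>\<close> of degree at most \<open>s\<close>, is bounded on \<open>[0, 1]\<close> by its value \<open>t x\<close> at 0, and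
  has slope at most \<open>- k * t x\<close> there, so Markov's inequality gives \<open>k \<le> 2 s\<^sup>2\<close>. Querying the variables of a
  maximal family of disjoint top monomials therefore costs at most \<open>2 s\<^sup>2 r\<close> queries and lowers the degree
  of \<open>p\<close>. If \<open>f x = 1\<close>, the same holds for \<open>q - p\<close>. After at most \<open>2 r\<close> such rounds one of the two is constant.
\<close>

section \<open>Markov's inequality at an endpoint\<close>

text \<open>The intermediate value theorem puts a root strictly between any two consecutive points.
  These \<open>m\<close> intervals are disjoint, so the roots are distinct, and a nonzero polynomial
  has at most \<open>degree p\<close> of them.\<close>

lemma degree_ge_sign_changes:
  fixes p :: "real poly" and z :: "nat \<Rightarrow> real"
  assumes decr: "\<And>j. j < m \<Longrightarrow> z (Suc j) < z j"
    and change: "\<And>j. j < m \<Longrightarrow> poly p (z (Suc j)) * poly p (z j) < 0"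
  shows "m \<le> degree p"
proof (cases "m = 0")
  case False
  then have "p \<noteq> 0"
    using change[of 0] by auto
  have "\<exists>r. z (Suc j) < r \<and> r < z j \<and> poly p r = 0" if "j < m" for j
    using poly_IVT[OF decr[OF that] change[OF that]] by blast
  then obtain r where r: "\<And>j. j < m \<Longrightarrow> z (Suc j) < r j \<and> r j < z j \<and> poly p (r j) = 0"
    by metis
  have anti: "z k \<le> z (Suc i)" if "i < k" "k \<le> m" for i k
    using that
  proof (induction k)
    case (Suc k)
    then show ?case
      using decr[of k] by (cases "i = k") auto
  qed simp
  have lt: "r k < r i" if "i < k" "k < m" for i k
    using anti[of i k] r[of i] r[of k] that by fastforce
  have "inj_on r {..<m}"
    by (intro inj_onI) (metis lt lessThan_iff less_irrefl linorder_neqE_nat)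
  then have "m = card (r ` {..<m})"
    by (simp add: card_image)
  also have "\<dots> \<le> card {x. poly p x = 0}"
    using r by (intro card_mono poly_roots_finite[OF \<open>p \<noteq> 0\<close>]) auto
  also have "\<dots> \<le> degree p"
    using card_poly_roots_bound[OF \<open>p \<noteq> 0\<close>] .
  finally show ?thesis .
qed simp

section \<open>Chebyshev polynomials and their extremal growth to the right of 1\<close>

fun chebyshev :: "nat \<Rightarrow> real poly" where
  "chebyshev 0 = 1"
| "chebyshev (Suc 0) = [:0, 1:]"
| "chebyshev (Suc (Suc n)) = [:0, 2:] * chebyshev (Suc n) - chebyshev n"

lemma degree_chebyshev_le: "degree (chebyshev n) \<le> n"
proof (induction n rule: chebyshev.induct)
  case (3 n)
  have "degree ([:0, 2:] * chebyshev (Suc n)) \<le> Suc (Suc n)"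
    using degree_mult_le[of "[:0, 2:]" "chebyshev (Suc n)"] 3 by simp
  then show ?case
    using 3 by (simp add: degree_diff_le del: mult_pCons_left)
qed auto

lemma poly_chebyshev_cos: "poly (chebyshev n) (cos \<theta>) = cos (real n * \<theta>)"
proof (induction n rule: chebyshev.induct)
  case (3 n)
  have "cos (real (Suc n) * \<theta> + \<theta>) + cos (real (Suc n) * \<theta> - \<theta>) = 2 * cos \<theta> * cos (real (Suc n) * \<theta>)"
    by (simp add: cos_add cos_diff)
  moreover have "real (Suc n) * \<theta> + \<theta> = real (Suc (Suc n)) * \<theta>" "real (Suc n) * \<theta> - \<theta> = real n * \<theta>"
    by (simp_all add: algebra_simps)
  ultimately show ?case
    using 3 by simp
qed auto

lemma poly_chebyshev_1: "poly (chebyshev n) 1 = 1"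
  using poly_chebyshev_cos[of n 0] by simp

text \<open>Differentiating the recurrence at 1 leaves the identity
  \<open>(n + 2)^2 = 2 + 2 * (n + 1)^2 - n^2\<close>.\<close>

lemma poly_pderiv_chebyshev_1: "poly (pderiv (chebyshev n)) 1 = (real n)\<^sup>2"
proof (induction n rule: chebyshev.induct)
  case (3 n)
  have "poly (pderiv (chebyshev (Suc (Suc n)))) 1 =
      2 * poly (chebyshev (Suc n)) 1 + 2 * poly (pderiv (chebyshev (Suc n))) 1 - poly (pderiv (chebyshev n)) 1"
    by (simp add: pderiv_diff pderiv_mult pderiv_pCons del: mult_pCons_left)
  then show ?case
    using 3 by (simp add: poly_chebyshev_1 power2_eq_square algebra_simps)
qed (auto simp: pderiv_pCons)

text \<open>Only the lower bound is wanted later. Monotonicity in the index is proved with it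
  because the recurrence subtracts \<open>chebyshev n\<close>, which must be compared with
  \<open>chebyshev (Suc n)\<close>.\<close>

lemma poly_chebyshev_ge_1:
  assumes "x \<ge> 1"
  shows "1 \<le> poly (chebyshev n) x \<and> poly (chebyshev n) x \<le> poly (chebyshev (Suc n)) x"
proof (induction n)
  case (Suc n)
  have "poly (chebyshev (Suc n)) x \<le> x * poly (chebyshev (Suc n)) x"
    using Suc assms mult_right_mono[of 1 x "poly (chebyshev (Suc n)) x"] by auto
  moreover have "poly (chebyshev (Suc (Suc n))) x = 2 * (x * poly (chebyshev (Suc n)) x) - poly (chebyshev n) x"
    by simp
  ultimately show ?case
    using Suc by linarith
qed (use assms in auto)

text \<open>A polynomial exceeding the Chebyshev polynomial at \<open>x\<close> could be shrunk
  slightly and still exceed it there. The difference of the two would then change sign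
  \<open>s + 1\<close> times, too often for degree \<open>s\<close>.\<close>

lemma poly_le_chebyshev:
  fixes p :: "real poly"
  assumes deg: "degree p \<le> s"
    and bound: "\<And>x. -1 \<le> x \<Longrightarrow> x \<le> 1 \<Longrightarrow> \<bar>poly p x\<bar> \<le> 1"
    and "1 < x"
  shows "poly p x \<le> poly (chebyshev s) x"
proof (rule ccontr)
  assume *: "\<not> poly p x \<le> poly (chebyshev s) x"
  have T: "1 \<le> poly (chebyshev s) x"
    using poly_chebyshev_ge_1[of x s] \<open>1 < x\<close> by simp
  \<comment> \<open>Scaling by \<open>c < 1\<close> makes the bound on \<open>[-1, 1]\<close>
    strict, while \<open>c\<close> is large enough that \<open>c * poly p x\<close> still exceeds
    the Chebyshev value.\<close>
  obtain c where c: "poly (chebyshev s) x / poly p x < c" "c < 1"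
    using * T dense[of "poly (chebyshev s) x / poly p x" 1] by auto
  have "0 < poly (chebyshev s) x / poly p x"
    using * T by (intro divide_pos_pos) auto
  with c have "0 < c"
    by linarith
  have cx: "poly (chebyshev s) x < c * poly p x"
    using * T c by (simp add: field_simps)
  \<comment> \<open>\<open>D\<close> alternates in sign at the \<open>s + 1\<close> extrema of the Chebyshev polynomial, and once more between 1 and \<open>x\<close>.\<close>
  define D where "D = chebyshev s - smult c p"
  define z where "z j = (case j of 0 \<Rightarrow> x | Suc i \<Rightarrow> cos (real i * pi / real s))" for j
  have sgn: "0 < (-1) ^ i * poly D (z (Suc i))" if "i \<le> s" for i
  proof -
    \<comment> \<open>For \<open>s = 0\<close> only \<open>i = 0\<close> occurs, and division by
      zero yields the angle 0, so the point is still 1.\<close>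
    have "real s * (real i * pi / real s) = real i * pi"
      using that by (cases "s = 0") auto
    then have "poly (chebyshev s) (z (Suc i)) = (-1) ^ i"
      by (simp add: z_def poly_chebyshev_cos)
    moreover have "\<bar>poly p (z (Suc i))\<bar> \<le> 1"
      by (rule bound) (simp_all add: z_def)
    then have "c * \<bar>poly p (z (Suc i))\<bar> < 1"
      using \<open>0 < c\<close> \<open>c < 1\<close> mult_left_mono[of "\<bar>poly p (z (Suc i))\<bar>" 1 c] by linarith
    then have "\<bar>c * poly p (z (Suc i))\<bar> < 1"
      using \<open>0 < c\<close> by (simp add: abs_mult)
    ultimately show ?thesis
      by (cases "even i") (auto simp: D_def)
  qed
  have "Suc s \<le> degree D"
  proof (rule degree_ge_sign_changes)
    fix j assume j: "j < Suc s"
    show "z (Suc j) < z j"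
    proof (cases j)
      case 0
      then show ?thesis
        using \<open>1 < x\<close> by (simp add: z_def)
    next
      case (Suc i)
      have "real i * pi / real s < real (Suc i) * pi / real s"
        using j Suc by (intro divide_strict_right_mono mult_strict_right_mono) auto
      moreover have "real (Suc i) * pi / real s \<le> pi"
        using j Suc by (simp add: field_simps del: of_nat_Suc)
      ultimately show ?thesis
        using Suc by (simp add: z_def cos_monotone_0_pi del: of_nat_Suc)
    qed
    show "poly D (z (Suc j)) * poly D (z j) < 0"
    proof (cases j)
      case 0
      have "poly D x < 0"
        using cx by (simp add: D_def)
      moreover have "z 0 = x"
        by (simp add: z_def)
      ultimately show ?thesis
        using sgn[of 0] 0 by (simp add: mult_pos_neg)
    next
      case (Suc i)
      show ?thesis
        using sgn[of i] sgn[of j] j Suc by (cases "even i") (auto intro: mult_pos_neg mult_neg_pos)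
    qed
  qed
  moreover have "degree D \<le> s"
    unfolding D_def using deg degree_chebyshev_le degree_smult_le[of c p]
    by (intro degree_diff_le) (auto intro: order_trans)
  ultimately show False
    by simp
qed

text \<open>Applied to a difference, this turns an inequality between two functions that agree at
  \<open>a\<close> into one between their derivatives at \<open>a\<close>.\<close>

lemma DERIV_nonneg_at_right_min:
  fixes g :: "real \<Rightarrow> real"
  assumes "(g has_real_derivative d) (at a)" "g a = 0" "a < b" "\<And>x. a < x \<Longrightarrow> x < b \<Longrightarrow> 0 \<le> g x"
  shows "0 \<le> d"
proof (rule ccontr)
  assume "\<not> 0 \<le> d"
  then obtain e where e: "e > 0" "\<And>h. 0 < h \<Longrightarrow> h < e \<Longrightarrow> g (a + h) < g a"
    using DERIV_neg_dec_right[OF assms(1)] by force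
  define h where "h = min e (b - a) / 2"
  have "0 < h" "h < e" "a + h < b"
    using e(1) \<open>a < b\<close> by (auto simp: h_def min_def field_simps)
  then show False
    using e(2)[of h] assms(2) assms(4)[of "a + h"] by auto
qed

text \<open>Since \<open>p\<close> attains its bound at 1, it agrees there with the Chebyshev
  polynomial and stays below it to the right. The slopes at 1 compare accordingly.\<close>

lemma Markov_at_max_endpoint:
  fixes p :: "real poly"
  assumes "degree p \<le> s"
    and "\<And>x. -1 \<le> x \<Longrightarrow> x \<le> 1 \<Longrightarrow> \<bar>poly p x\<bar> \<le> 1"
    and "poly p 1 = 1"
  shows "poly (pderiv p) 1 \<le> (real s)\<^sup>2"
proof -
  have "0 \<le> poly (pderiv (chebyshev s - p)) 1"
  proof (rule DERIV_nonneg_at_right_min[where g = "poly (chebyshev s - p)" and a = 1 and b = 2])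
    show "0 \<le> poly (chebyshev s - p) x" if "1 < x" for x
      using poly_le_chebyshev[OF assms(1,2) that] by simp
  qed (use assms(3) in \<open>auto simp: poly_chebyshev_1 poly_DERIV\<close>)
  then show ?thesis
    by (simp add: pderiv_diff poly_pderiv_chebyshev_1)
qed

section \<open>Multilinear functions on the cube\<close>

text \<open>A multilinear polynomial is encoded by its coefficients, indexed by sets of variables.
  The variable set \<open>V\<close> is explicit because it shrinks as bits are queried.\<close>

definition ml_eval :: "nat set \<Rightarrow> (nat set \<Rightarrow> real) \<Rightarrow> (nat \<Rightarrow> bool) \<Rightarrow> real" where
  "ml_eval V c x = (\<Sum>S\<in>Pow V. c S * (\<Prod>i\<in>S. of_bool (x i)))"

definition ml_degree_le :: "(nat set \<Rightarrow> real) \<Rightarrow> nat \<Rightarrow> bool" where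
  "ml_degree_le c d \<longleftrightarrow> (\<forall>S. d < card S \<longrightarrow> c S = 0)"

text \<open>Fixing the bits in \<open>A\<close> to \<open>a\<close> collapses all monomials
  \<open>S \<union> U\<close> with \<open>U \<subseteq> A\<close> onto \<open>S\<close>.\<close>

definition ml_restrict :: "(nat set \<Rightarrow> real) \<Rightarrow> nat set \<Rightarrow> (nat \<Rightarrow> bool) \<Rightarrow> nat set \<Rightarrow> real" where
  "ml_restrict c A a S = (if finite S \<and> S \<inter> A = {} then \<Sum>U\<in>Pow A. c (S \<union> U) * (\<Prod>i\<in>U. of_bool (a i)) else 0)"

lemma ml_eval_cong:
  assumes "\<And>i. i \<in> V \<Longrightarrow> x i = y i"
  shows "ml_eval V c x = ml_eval V c y"
  unfolding ml_eval_def using assms by (intro sum.cong arg_cong2[where f = times] prod.cong refl) auto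

text \<open>Each monomial \<open>W \<subseteq> V\<close> splits uniquely into \<open>W - A\<close>
  and \<open>W \<inter> A\<close>, so the double sum is a reindexing of the single one.\<close>

lemma ml_eval_restrict:
  assumes "finite V" "A \<subseteq> V"
  shows "ml_eval (V - A) (ml_restrict c A a) x = ml_eval V c (override_on x a A)"
proof -
  let ?y = "override_on x a A"
  have fin: "finite A"
    using assms finite_subset by blast
  have "ml_eval (V - A) (ml_restrict c A a) x =
      (\<Sum>S\<in>Pow (V - A). \<Sum>U\<in>Pow A. c (S \<union> U) * (\<Prod>i\<in>S \<union> U. of_bool (?y i)))"
    unfolding ml_eval_def
  proof (rule sum.cong[OF refl])
    fix S assume S: "S \<in> Pow (V - A)"
    then have finS: "finite S" and SA: "S \<inter> A = {}"
      using assms(1) by (auto intro: finite_subset)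
    have "(\<Prod>i\<in>S \<union> U. of_bool (?y i)) = (\<Prod>i\<in>U. of_bool (a i)) * (\<Prod>i\<in>S. of_bool (x i) :: real)"
      if U: "U \<in> Pow A" for U
    proof -
      have "(\<Prod>i\<in>S \<union> U. of_bool (?y i) :: real) = (\<Prod>i\<in>S. of_bool (?y i)) * (\<Prod>i\<in>U. of_bool (?y i))"
        using U SA finS fin by (intro prod.union_disjoint) (auto intro: finite_subset)
      also have "(\<Prod>i\<in>S. of_bool (?y i) :: real) = (\<Prod>i\<in>S. of_bool (x i))"
        using SA by (intro prod.cong) (auto simp: override_on_def)
      also have "(\<Prod>i\<in>U. of_bool (?y i) :: real) = (\<Prod>i\<in>U. of_bool (a i))"
        using U by (intro prod.cong) (auto simp: override_on_def)
      finally show ?thesis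
        by simp
    qed
    then show "ml_restrict c A a S * (\<Prod>i\<in>S. of_bool (x i)) =
        (\<Sum>U\<in>Pow A. c (S \<union> U) * (\<Prod>i\<in>S \<union> U. of_bool (?y i)))"
      using finS SA by (simp add: ml_restrict_def sum_distrib_right mult.assoc)
  qed
  also have "\<dots> = (\<Sum>(S, U)\<in>Pow (V - A) \<times> Pow A. c (S \<union> U) * (\<Prod>i\<in>S \<union> U. of_bool (?y i)))"
    by (simp add: sum.cartesian_product)
  also have "\<dots> = ml_eval V c ?y"
    unfolding ml_eval_def
    by (rule sum.reindex_bij_witness[where i = "\<lambda>W. (W - A, W \<inter> A)" and j = "\<lambda>(S, U). S \<union> U"])
      (use assms in \<open>auto simp: Un_Diff_Int\<close>)
  finally show ?thesis .
qed

text \<open>A nonempty \<open>U\<close> would push \<open>S \<union> U\<close> above degree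
  \<open>d\<close>, so only the original coefficient contributes to \<open>S\<close>.\<close>

lemma ml_restrict_top:
  assumes "ml_degree_le c d" "finite S" "finite A" "S \<inter> A = {}" "d \<le> card S"
  shows "ml_restrict c A a S = c S"
proof -
  have "c (S \<union> U) = 0" if "U \<in> Pow A - {{}}" for U
  proof -
    have "finite U" "U \<noteq> {}" "S \<inter> U = {}"
      using that assms finite_subset by auto
    then have "card S < card (S \<union> U)"
      using assms(2) by (simp add: card_Un_disjoint card_gt_0_iff)
    then show ?thesis
      using assms(1,5) unfolding ml_degree_le_def by (meson le_less_trans)
  qed
  then have "(\<Sum>U\<in>Pow A. c (S \<union> U) * (\<Prod>i\<in>U. of_bool (a i))) = (\<Sum>U\<in>{{}}. c (S \<union> U) * (\<Prod>i\<in>U. of_bool (a i)))"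
    using assms(3) by (intro sum.mono_neutral_right) auto
  then show ?thesis
    using assms by (simp add: ml_restrict_def)
qed

lemma ml_degree_le_restrict:
  assumes "ml_degree_le c d" "finite A"
  shows "ml_degree_le (ml_restrict c A a) d"
  unfolding ml_degree_le_def
proof (intro allI impI)
  fix S :: "nat set" assume S: "d < card S"
  show "ml_restrict c A a S = 0"
  proof (cases "S \<inter> A = {}")
    case True
    then show ?thesis
      using ml_restrict_top[OF assms(1) _ assms(2), of S a] S assms(1)
      by (metis card.infinite less_imp_le ml_degree_le_def not_less_zero)
  qed (auto simp: ml_restrict_def)
qed

text \<open>A monomial of degree \<open>Suc d\<close> surviving the restriction would be an original
  one avoiding \<open>A\<close>. Hence the degree drops for every outcome \<open>a\<close> of the
  queries.\<close>

lemma ml_degree_le_restrict_hitting: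
  assumes "ml_degree_le c (Suc d)" "finite A" "\<And>S. card S = Suc d \<Longrightarrow> c S \<noteq> 0 \<Longrightarrow> S \<inter> A \<noteq> {}"
  shows "ml_degree_le (ml_restrict c A a) d"
  unfolding ml_degree_le_def
proof (intro allI impI)
  fix S :: "nat set" assume S: "d < card S"
  then have fin: "finite S"
    by (metis card.infinite not_less_zero)
  show "ml_restrict c A a S = 0"
  proof (cases "S \<inter> A = {}")
    case True
    then have "ml_restrict c A a S = c S"
      using ml_restrict_top[OF assms(1) fin assms(2)] S by simp
    also have "c S = 0"
    proof (cases "card S = Suc d")
      case False
      then show ?thesis
        using assms(1) S unfolding ml_degree_le_def by (metis Suc_lessI)
    qed (use assms(3) True in blast)
    finally show ?thesis .
  qed (auto simp: ml_restrict_def)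
qed

text \<open>Evaluate at the indicator of \<open>S\<close>: only subsets of \<open>S\<close>
  contribute, and the proper ones have coefficient 0 by induction.\<close>

lemma ml_eval_eq_0_imp_coeff_0:
  assumes "finite V" "\<And>x. ml_eval V c x = 0" "S \<subseteq> V"
  shows "c S = 0"
  using assms(3)
proof (induction "card S" arbitrary: S rule: less_induct)
  case less
  have fin: "finite S"
    using less.prems assms(1) finite_subset by blast
  have "ml_eval V c (\<lambda>i. i \<in> S) = (\<Sum>T\<in>Pow S. c T * (\<Prod>i\<in>T. of_bool (i \<in> S)))"
    unfolding ml_eval_def
  proof (rule sum.mono_neutral_right)
    show "\<forall>T\<in>Pow V - Pow S. c T * (\<Prod>i\<in>T. of_bool (i \<in> S)) = 0"
    proof
      fix T assume T: "T \<in> Pow V - Pow S"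
      then have "finite T"
        using assms(1) finite_subset by auto
      then have "(\<Prod>i\<in>T. of_bool (i \<in> S)) = (0::real)"
        by (rule prod_zero) (use T in auto)
      then show "c T * (\<Prod>i\<in>T. of_bool (i \<in> S)) = 0"
        by simp
    qed
  qed (use less.prems assms(1) in auto)
  also have "\<dots> = (\<Sum>T\<in>{S}. c T * (\<Prod>i\<in>T. of_bool (i \<in> S)))"
  proof (rule sum.mono_neutral_right)
    have "c T = 0" if "T \<subset> S" for T
      using less.hyps[OF psubset_card_mono[OF fin that]] less.prems that by blast
    then show "\<forall>T\<in>Pow S - {S}. c T * (\<Prod>i\<in>T. of_bool (i \<in> S)) = 0"
      by auto
  qed (use fin in auto)
  also have "\<dots> = c S"
    by simp
  finally show ?case
    using assms(2) by simp
qed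

text \<open>Fix the variables outside \<open>S\<close> as in \<open>x\<close>. The coefficient of
  \<open>S\<close> survives because \<open>S\<close> has top degree, so the remaining polynomial in
  the variables of \<open>S\<close> is not identically zero.\<close>

lemma top_monomial_nonzero:
  assumes "finite V" "ml_degree_le c d" "S \<subseteq> V" "card S = d" "c S \<noteq> 0"
  shows "\<exists>w. ml_eval V c (override_on x w S) \<noteq> 0"
proof (rule ccontr)
  assume *: "\<not> ?thesis"
  have VS: "V - (V - S) = S"
    using assms(3) by blast
  have "ml_eval S (ml_restrict c (V - S) x) w = 0" for w
  proof -
    have "ml_eval S (ml_restrict c (V - S) x) w = ml_eval V c (override_on w x (V - S))"
      using ml_eval_restrict[OF assms(1), of "V - S" c x w] unfolding VS by blast
    also have "\<dots> = ml_eval V c (override_on x w S)"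
      by (rule ml_eval_cong) (auto simp: override_on_def)
    finally show ?thesis
      using * by simp
  qed
  then have "ml_restrict c (V - S) x S = 0"
    by (rule ml_eval_eq_0_imp_coeff_0[OF finite_subset[OF assms(3,1)] _ order_refl])
  moreover have "ml_restrict c (V - S) x S = c S"
    using assms(1,4) finite_subset[OF assms(3,1)] by (simp add: ml_restrict_top[OF assms(2)])
  ultimately show False
    using assms(5) by simp
qed

section \<open>Disjoint sensitive blocks at an extremal point\<close>

text \<open>Picking from each such block an element of \<open>W\<close> is injective, since the
  blocks are disjoint.\<close>

lemma card_meeting_le:
  assumes "finite W" "pairwise disjnt F"
  shows "card {S \<in> F. S \<inter> W \<noteq> {}} \<le> card W"
proof -
  define g where "g S = (SOME i. i \<in> S \<inter> W)" for S
  have g: "g S \<in> S \<inter> W" if "S \<inter> W \<noteq> {}" for S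
    unfolding g_def using that by (metis all_not_in_conv someI_ex)
  have "inj_on g {S \<in> F. S \<inter> W \<noteq> {}}"
  proof (rule inj_onI)
    fix S T assume *: "S \<in> {S \<in> F. S \<inter> W \<noteq> {}}" "T \<in> {S \<in> F. S \<inter> W \<noteq> {}}" "g S = g T"
    then have "g S \<in> S" "g S \<in> T"
      using g[of S] g[of T] by auto
    then show "S = T"
      using * assms(2) by (auto simp: pairwise_def disjnt_def)
  qed
  then show ?thesis
    by (rule card_inj_on_le) (use g assms(1) in auto)
qed

text \<open>Factoring a monomial block by block is what lets independent switches of the blocks turn
  its expectation into a product.\<close>

lemma prod_override_blocks:
  fixes x w :: "nat \<Rightarrow> bool"
  assumes "finite W" "finite F" "pairwise disjnt F" "y \<subseteq> F"
  shows "(\<Prod>i\<in>W. of_bool (override_on x w (\<Union>y) i) :: real) =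
    (\<Prod>i\<in>W - \<Union>F. of_bool (x i)) *
    ((\<Prod>S\<in>y. \<Prod>i\<in>W \<inter> S. of_bool (w i)) * (\<Prod>S\<in>F - y. \<Prod>i\<in>W \<inter> S. of_bool (x i)))"
proof -
  let ?g = "\<lambda>i. of_bool (override_on x w (\<Union>y) i) :: real"
  have "prod ?g W = prod ?g (W - \<Union>F) * prod ?g (W \<inter> \<Union>F)"
    using assms(1) by (subst prod.union_disjoint[symmetric]) (auto intro!: prod.cong)
  also have "prod ?g (W - \<Union>F) = (\<Prod>i\<in>W - \<Union>F. of_bool (x i))"
    using assms(4) by (intro prod.cong) (auto simp: override_on_def)
  also have "W \<inter> \<Union>F = (\<Union>S\<in>F. W \<inter> S)"
    by blast
  also have "prod ?g \<dots> = (\<Prod>S\<in>F. prod ?g (W \<inter> S))"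
    using assms by (intro prod.UNION_disjoint) (auto simp: pairwise_def disjnt_def)
  also have "\<dots> = (\<Prod>S\<in>y. prod ?g (W \<inter> S)) * (\<Prod>S\<in>F - y. prod ?g (W \<inter> S))"
    using prod.subset_diff[OF assms(4,2), of "\<lambda>S. prod ?g (W \<inter> S)"] by (simp add: mult.commute)
  also have "(\<Prod>S\<in>y. prod ?g (W \<inter> S)) = (\<Prod>S\<in>y. \<Prod>i\<in>W \<inter> S. of_bool (w i))"
    by (intro prod.cong) (auto simp: override_on_def)
  also have "(\<Prod>S\<in>F - y. prod ?g (W \<inter> S)) = (\<Prod>S\<in>F - y. \<Prod>i\<in>W \<inter> S. of_bool (x i))"
    using assms(3,4) by (intro prod.cong refl) (fastforce simp: override_on_def pairwise_def disjnt_def)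
  finally show ?thesis .
qed

text \<open>
  The sum is the expectation of \<open>t\<close> when each block of \<open>F\<close> is switched from \<open>x\<close> to \<open>w\<close> with probability \<open>\<theta>\<close>.
  A monomial on \<open>W\<close> depends only on the at most \<open>card W\<close> blocks that meet \<open>W\<close>, whence the degree bound.
\<close>

lemma block_expectation_poly:
  assumes "finite V" "finite F" "pairwise disjnt F" "ml_degree_le t s"
  obtains G :: "real poly" where "degree G \<le> s"
    and "\<And>\<theta>. poly G \<theta> =
      (\<Sum>y\<in>Pow F. \<theta> ^ card y * (1 - \<theta>) ^ card (F - y) * ml_eval V t (override_on x w (\<Union>y)))"
proof -
  define u where "u W S = (\<Prod>i\<in>W \<inter> S. of_bool (w i) :: real)" for W S
  define v where "v W S = (\<Prod>i\<in>W \<inter> S. of_bool (x i) :: real)" for W S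
  define k where "k W = t W * (\<Prod>i\<in>W - \<Union>F. of_bool (x i) :: real)" for W
  \<comment> \<open>The linear factor takes the value
    \<open>\<theta> * u W S + (1 - \<theta>) * v W S\<close>, the expected contribution of block
    \<open>S\<close> to the monomial \<open>W\<close>.\<close>
  define G where "G = (\<Sum>W\<in>Pow V. smult (k W) (\<Prod>S\<in>{S \<in> F. S \<inter> W \<noteq> {}}. [:v W S, u W S - v W S:]))"
  have "degree G \<le> s"
    unfolding G_def
  proof (rule degree_sum_le)
    fix W assume W: "W \<in> Pow V"
    show "degree (smult (k W) (\<Prod>S\<in>{S \<in> F. S \<inter> W \<noteq> {}}. [:v W S, u W S - v W S:])) \<le> s"
    proof (cases "t W = 0")
      case False
      have "degree (\<Prod>S\<in>{S \<in> F. S \<inter> W \<noteq> {}}. [:v W S, u W S - v W S:])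
          \<le> (\<Sum>S\<in>{S \<in> F. S \<inter> W \<noteq> {}}. degree [:v W S, u W S - v W S:])"
        using degree_prod_sum_le[of "{S \<in> F. S \<inter> W \<noteq> {}}" "\<lambda>S. [:v W S, u W S - v W S:]"] assms(2)
        by (simp add: o_def)
      also have "\<dots> \<le> card {S \<in> F. S \<inter> W \<noteq> {}}"
        using sum_bounded_above[of "{S \<in> F. S \<inter> W \<noteq> {}}" "\<lambda>S. degree [:v W S, u W S - v W S:]" 1]
        by simp
      also have "\<dots> \<le> card W"
        using W assms(1,3) by (intro card_meeting_le) (auto intro: finite_subset)
      also have "\<dots> \<le> s"
        using False assms(4) by (auto simp: ml_degree_le_def not_less[symmetric])
      finally show ?thesis
        using degree_smult_le order_trans by blast
    qed (simp add: k_def)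
  qed (use assms(1) in simp)
  moreover have "poly G \<theta> =
      (\<Sum>y\<in>Pow F. \<theta> ^ card y * (1 - \<theta>) ^ card (F - y) * ml_eval V t (override_on x w (\<Union>y)))" for \<theta>
  proof -
    have "poly G \<theta> = (\<Sum>W\<in>Pow V. k W * (\<Prod>S\<in>{S \<in> F. S \<inter> W \<noteq> {}}. \<theta> * u W S + (1 - \<theta>) * v W S))"
      by (simp add: G_def poly_sum poly_prod algebra_simps)
    also have "\<dots> = (\<Sum>W\<in>Pow V. \<Sum>y\<in>Pow F. \<theta> ^ card y * (1 - \<theta>) ^ card (F - y) *
        (t W * (\<Prod>i\<in>W. of_bool (override_on x w (\<Union>y) i))))"
    proof (rule sum.cong[OF refl])
      fix W assume "W \<in> Pow V"
      then have W: "finite W"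
        using assms(1) by (auto intro: finite_subset)
      \<comment> \<open>A block missing \<open>W\<close> gives empty products
        \<open>u W S = v W S = 1\<close>, hence the factor 1.\<close>
      have "(\<Prod>S\<in>{S \<in> F. S \<inter> W \<noteq> {}}. \<theta> * u W S + (1 - \<theta>) * v W S) = (\<Prod>S\<in>F. \<theta> * u W S + (1 - \<theta>) * v W S)"
        using assms(2) by (intro prod.mono_neutral_left) (auto simp: u_def v_def Int_commute)
      \<comment> \<open>Expanding the product chooses, for each block, whether it is switched;
        \<open>y\<close> collects the switched ones.\<close>
      also have "\<dots> = (\<Sum>y\<in>Pow F. (\<Prod>S\<in>y. \<theta> * u W S) * (\<Prod>S\<in>F - y. (1 - \<theta>) * v W S))"
        using assms(2) by (rule prod_add)
      finally have "k W * (\<Prod>S\<in>{S \<in> F. S \<inter> W \<noteq> {}}. \<theta> * u W S + (1 - \<theta>) * v W S) =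
          (\<Sum>y\<in>Pow F. k W * ((\<Prod>S\<in>y. \<theta> * u W S) * (\<Prod>S\<in>F - y. (1 - \<theta>) * v W S)))"
        by (simp add: sum_distrib_left)
      also have "\<dots> = (\<Sum>y\<in>Pow F. \<theta> ^ card y * (1 - \<theta>) ^ card (F - y) *
          (t W * (\<Prod>i\<in>W. of_bool (override_on x w (\<Union>y) i))))"
      proof (rule sum.cong[OF refl])
        fix y assume "y \<in> Pow F"
        then show "k W * ((\<Prod>S\<in>y. \<theta> * u W S) * (\<Prod>S\<in>F - y. (1 - \<theta>) * v W S)) =
            \<theta> ^ card y * (1 - \<theta>) ^ card (F - y) * (t W * (\<Prod>i\<in>W. of_bool (override_on x w (\<Union>y) i)))"
          using prod_override_blocks[OF W assms(2,3), of y x w]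
          by (simp add: k_def u_def v_def prod.distrib)
      qed
      finally show "k W * (\<Prod>S\<in>{S \<in> F. S \<inter> W \<noteq> {}}. \<theta> * u W S + (1 - \<theta>) * v W S) = \<dots>" .
    qed
    also have "\<dots> = (\<Sum>y\<in>Pow F. \<theta> ^ card y * (1 - \<theta>) ^ card (F - y) * ml_eval V t (override_on x w (\<Union>y)))"
      by (subst sum.swap) (simp add: ml_eval_def sum_distrib_left)
    finally show ?thesis .
  qed
  ultimately show ?thesis
    using that by blast
qed

lemma card_sensitive_blocks_le:
  assumes "finite V" "finite F" "pairwise disjnt F" "ml_degree_le t s"
    and pos: "0 < ml_eval V t x"
    and max: "\<And>y. \<bar>ml_eval V t y\<bar> \<le> ml_eval V t x"
    and sens: "\<And>S. S \<in> F \<Longrightarrow> ml_eval V t (override_on x w S) \<le> 0"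
  shows "card F \<le> 2 * s\<^sup>2"
proof -
  obtain G :: "real poly" where degG: "degree G \<le> s"
    and G: "\<And>\<theta>. poly G \<theta> =
      (\<Sum>y\<in>Pow F. \<theta> ^ card y * (1 - \<theta>) ^ card (F - y) * ml_eval V t (override_on x w (\<Union>y)))"
    using block_expectation_poly[OF assms(1-4)] by blast
  define M where "M = ml_eval V t x"
  define k where "k = card F"
  \<comment> \<open>The substitution \<open>(1 - z) / 2\<close> maps \<open>[-1, 1]\<close> onto
    \<open>[0, 1]\<close> and sends 1 to 0, so that the maximum of \<open>G\<close> at 0 becomes the
    value 1 of \<open>P\<close> at 1. It also halves the slope, which is the source of the factor
    2.\<close>
  define P where "P = smult (1 / M) (pcompose G [:1/2, -1/2:])"
  have M: "0 < M"
    using pos by (simp add: M_def)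
  have weights: "(\<Sum>y\<in>Pow F. \<theta> ^ card y * (1 - \<theta>) ^ card (F - y)) = 1" for \<theta> :: real
    using prod_add[OF assms(2), of "\<lambda>_. \<theta>" "\<lambda>_. 1 - \<theta>"] by simp
  have G0: "poly G 0 = M"
  proof -
    \<comment> \<open>At 0 only the empty family has positive weight, because
      \<open>0 ^ 0 = 1\<close>.\<close>
    have "poly G 0 = (\<Sum>y\<in>{{}}. 0 ^ card y * (1 - 0) ^ card (F - y) * ml_eval V t (override_on x w (\<Union>y)))"
      unfolding G using assms(2) by (intro sum.mono_neutral_right) (auto simp: card_eq_0_iff dest: finite_subset)
    then show ?thesis
      by (simp add: M_def override_on_def)
  qed
  have G_abs: "\<bar>poly G \<theta>\<bar> \<le> M" if "0 \<le> \<theta>" "\<theta> \<le> 1" for \<theta>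
  proof -
    have "\<bar>poly G \<theta>\<bar> \<le> (\<Sum>y\<in>Pow F. \<theta> ^ card y * (1 - \<theta>) ^ card (F - y) * M)"
      unfolding G using that max
      by (intro order_trans[OF sum_abs] sum_mono) (auto simp: abs_mult M_def intro!: mult_left_mono)
    also have "\<dots> = M"
      by (simp add: sum_distrib_right[symmetric] weights)
    finally show ?thesis .
  qed
  \<comment> \<open>With probability \<open>k * \<theta> * (1 - \<theta>) ^ (k - 1)\<close> exactly
    one block is switched and \<open>t\<close> is at most 0; every other outcome gives at most
    \<open>M\<close>.\<close>
  have G_le: "poly G \<theta> \<le> M - M * (real k * \<theta> * (1 - \<theta>) ^ (k - 1))" if "0 \<le> \<theta>" "\<theta> \<le> 1" for \<theta>
  proof -
    have "poly G \<theta> \<le> (\<Sum>y\<in>Pow F. \<theta> ^ card y * (1 - \<theta>) ^ card (F - y) * (M - M * of_bool (card y = 1)))"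
      unfolding G
    proof (intro sum_mono mult_left_mono)
      fix y assume "y \<in> Pow F"
      show "ml_eval V t (override_on x w (\<Union>y)) \<le> M - M * of_bool (card y = 1)"
      proof (cases "card y = 1")
        case True
        then obtain S where "y = {S}"
          using card_1_singletonE by blast
        then show ?thesis
          using sens[of S] \<open>y \<in> Pow F\<close> by simp
      next
        case False
        then show ?thesis
          using max[of "override_on x w (\<Union>y)"] by (simp add: M_def abs_le_iff)
      qed
    qed (use that in simp)
    also have "\<dots> = M * (\<Sum>y\<in>Pow F. \<theta> ^ card y * (1 - \<theta>) ^ card (F - y)) -
        M * (\<Sum>y\<in>Pow F. \<theta> ^ card y * (1 - \<theta>) ^ card (F - y) * of_bool (card y = 1))"
      by (simp add: sum_distrib_left sum_subtractf[symmetric] algebra_simps)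
    also have "(\<Sum>y\<in>Pow F. \<theta> ^ card y * (1 - \<theta>) ^ card (F - y) * of_bool (card y = 1)) =
        (\<Sum>y\<in>(\<lambda>S. {S}) ` F. \<theta> ^ card y * (1 - \<theta>) ^ card (F - y) * of_bool (card y = 1))"
      using assms(2) by (intro sum.mono_neutral_right) (auto simp: card_1_singleton_iff)
    also have "\<dots> = (\<Sum>S\<in>F. \<theta> * (1 - \<theta>) ^ (k - 1))"
      using assms(2) by (subst sum.reindex) (auto simp: k_def card_Diff_singleton)
    also have "\<dots> = real k * \<theta> * (1 - \<theta>) ^ (k - 1)"
      by (simp add: k_def)
    finally show ?thesis
      by (simp add: weights)
  qed
  \<comment> \<open>Both sides of \<open>G_le\<close> equal \<open>M\<close> at 0, and the right
    side has slope \<open>- (M * real k)\<close> there.\<close>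
  have "0 \<le> - (M * real k) - poly (pderiv G) 0"
  proof (rule DERIV_nonneg_at_right_min[where b = 1])
    show "((\<lambda>\<theta>. M - M * (real k * \<theta> * (1 - \<theta>) ^ (k - 1)) - poly G \<theta>) has_real_derivative
        - (M * real k) - poly (pderiv G) 0) (at 0)"
      by (auto intro!: derivative_eq_intros poly_DERIV)
  qed (use G0 G_le in auto)
  moreover have "poly (pderiv P) 1 = - poly (pderiv G) 0 / (2 * M)"
    by (simp add: P_def pderiv_smult pderiv_pcompose poly_pcompose pderiv_pCons)
  moreover have "M * real k / (2 * M) = real k / 2"
    using M by simp
  ultimately have "real k / 2 \<le> poly (pderiv P) 1"
    using M divide_right_mono[of "M * real k" "- poly (pderiv G) 0" "2 * M"] by simp
  also have "\<dots> \<le> (real s)\<^sup>2"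
  proof (rule Markov_at_max_endpoint)
    show "degree P \<le> s"
      using degG degree_pcompose_le[of G "[:1/2, -1/2:]"] by (simp add: P_def M)
    show "\<bar>poly P z\<bar> \<le> 1" if "-1 \<le> z" "z \<le> 1" for z
      using G_abs[of "1/2 - z/2"] that M by (simp add: P_def poly_pcompose field_simps)
    show "poly P 1 = 1"
      using G0 M by (simp add: P_def poly_pcompose)
  qed
  finally have "real k \<le> real (2 * s\<^sup>2)"
    by simp
  then show ?thesis
    unfolding k_def by (simp only: of_nat_le_iff)
qed

section \<open>The decision tree\<close>

text \<open>\<open>A\<close> is the union of a maximal disjoint family of top monomials. The Boolean
  function enters only through \<open>sens\<close>, so the same statement serves \<open>p\<close>
  with \<open>t\<close> and its counterpart for the complement with \<open>- t\<close>.\<close>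

lemma exists_hitting_set:
  assumes V: "finite V" and supp: "\<And>S. p S \<noteq> 0 \<Longrightarrow> S \<subseteq> V"
    and p: "ml_degree_le p d" "0 < d" and t: "ml_degree_le t s"
    and pos: "0 < ml_eval V t x"
    and max: "\<And>y. \<bar>ml_eval V t y\<bar> \<le> ml_eval V t x"
    and sens: "\<And>y. ml_eval V p y \<noteq> 0 \<Longrightarrow> ml_eval V t y \<le> 0"
  obtains A where "A \<subseteq> V" "card A \<le> 2 * s\<^sup>2 * d"
    "\<And>S. card S = d \<Longrightarrow> p S \<noteq> 0 \<Longrightarrow> S \<inter> A \<noteq> {}"
proof -
  define tops where "tops = {S. card S = d \<and> p S \<noteq> 0}"
  have "tops \<subseteq> Pow V"
    using supp by (auto simp: tops_def)
  then have fin: "finite tops"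
    using V finite_subset by auto
  define families where "families = {F. F \<subseteq> tops \<and> pairwise disjnt F}"
  have "finite families" "{} \<in> families"
    using fin by (auto simp: families_def)
  then obtain F where "F \<in> families" and maximal: "\<forall>F'\<in>families. F \<subseteq> F' \<longrightarrow> F = F'"
    using finite_has_maximal2 by blast
  then have F: "F \<subseteq> tops" "pairwise disjnt F"
    by (simp_all add: families_def)
  have finF: "finite F"
    using F fin finite_subset by blast
  have "\<exists>w. ml_eval V p (override_on x w S) \<noteq> 0" if "S \<in> F" for S
    using that F(1) supp p by (intro top_monomial_nonzero[OF V p(1)]) (auto simp: tops_def)
  then obtain g where g: "\<And>S. S \<in> F \<Longrightarrow> ml_eval V p (override_on x (g S) S) \<noteq> 0"
    by metis
  \<comment> \<open>The blocks are disjoint, so their separate resettings \<open>g S\<close> glue to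
    a single \<open>w\<close>, as the bound on sensitive blocks requires.\<close>
  define w where "w i = g (THE S. S \<in> F \<and> i \<in> S) i" for i
  have w: "override_on x w S = override_on x (g S) S" if "S \<in> F" for S
  proof -
    have "(THE T. T \<in> F \<and> i \<in> T) = S" if "i \<in> S" for i
      using F(2) \<open>S \<in> F\<close> that by (intro the_equality) (auto simp: pairwise_def disjnt_def)
    then show ?thesis
      by (auto simp: override_on_def w_def)
  qed
  have "card F \<le> 2 * s\<^sup>2"
    using card_sensitive_blocks_le[OF V finF F(2) t pos max, of w] sens g w by simp
  moreover have "card (\<Union>F) \<le> card F * d"
  proof -
    have "card (\<Union>F) \<le> (\<Sum>S\<in>F. card S)"
      by (rule card_Union_le_sum_card)
    also have "\<dots> = (\<Sum>S\<in>F. d)"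
      using F(1) by (intro sum.cong) (auto simp: tops_def)
    finally show ?thesis
      by simp
  qed
  ultimately have "card (\<Union>F) \<le> 2 * s\<^sup>2 * d"
    by (meson le_trans mult_le_mono1)
  moreover have "S \<inter> \<Union>F \<noteq> {}" if S: "card S = d" "p S \<noteq> 0" for S
  proof
    assume *: "S \<inter> \<Union>F = {}"
    then have "pairwise disjnt (insert S F)"
      using F(2) by (auto simp: pairwise_insert disjnt_def)
    then have "insert S F \<in> families"
      using S F(1) by (simp add: families_def tops_def)
    \<comment> \<open>By maximality \<open>S\<close> already belongs to \<open>F\<close>; being
      disjoint from the union of \<open>F\<close> it would be empty, against
      \<open>0 < d\<close>.\<close>
    then have "S \<in> F"
      using maximal by blast
    then have "S = {}"
      using * by blast
    then show False
      using S p(2) by simp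
  qed
  moreover have "\<Union>F \<subseteq> V"
    using F(1) \<open>tops \<subseteq> Pow V\<close> by blast
  ultimately show ?thesis
    using that by blast
qed

text \<open>\<open>P\<close> records the bits already known: the induction hypothesis is used with
  \<open>P x \<and> x j = b\<close> for both answers \<open>b\<close>, and the two trees are joined
  by a query of \<open>j\<close>.\<close>

lemma dtree_query_all:
  assumes "finite A" "A \<subseteq> V"
    and "\<And>a. \<exists>T. queries T \<subseteq> V \<and> depth T \<le> d \<and> (\<forall>x. P x \<longrightarrow> (\<forall>i\<in>A. x i = a i) \<longrightarrow> run T x = f x)"
  shows "\<exists>T. queries T \<subseteq> V \<and> depth T \<le> card A + d \<and> (\<forall>x. P x \<longrightarrow> run T x = f x)"
  using assms
proof (induction A arbitrary: P rule: finite_induct)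
  case (insert j A)
  have "\<exists>T. queries T \<subseteq> V \<and> depth T \<le> card A + d \<and> (\<forall>x. (P x \<and> x j = b) \<longrightarrow> run T x = f x)" for b
  proof (rule insert.IH)
    fix a
    obtain T where "queries T \<subseteq> V" "depth T \<le> d"
      and T: "\<And>x. P x \<Longrightarrow> \<forall>i\<in>insert j A. x i = (a(j := b)) i \<Longrightarrow> run T x = f x"
      using insert.prems(2)[of "a(j := b)"] by blast
    moreover have "run T x = f x" if "P x \<and> x j = b" "\<forall>i\<in>A. x i = a i" for x
      using that insert.hyps by (intro T) auto
    ultimately show "\<exists>T. queries T \<subseteq> V \<and> depth T \<le> d \<and>
        (\<forall>x. (P x \<and> x j = b) \<longrightarrow> (\<forall>i\<in>A. x i = a i) \<longrightarrow> run T x = f x)"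
      by blast
  qed (use insert.prems in auto)
  then obtain T where T: "\<And>b. queries (T b) \<subseteq> V" "\<And>b. depth (T b) \<le> card A + d"
    "\<And>b x. P x \<Longrightarrow> x j = b \<Longrightarrow> run (T b) x = f x"
    by metis
  show ?case
    using T insert.prems(1) insert.hyps
    by (intro exI[of _ "Query j (T False) (T True)"]) auto
qed auto

lemma ml_eval_degree_0:
  assumes "finite V" "ml_degree_le c 0"
  shows "ml_eval V c x = c {}"
proof -
  have "ml_eval V c x = (\<Sum>S\<in>{{}}. c S * (\<Prod>i\<in>S. of_bool (x i)))"
    unfolding ml_eval_def
  proof (rule sum.mono_neutral_right)
    show "\<forall>S\<in>Pow V - {{}}. c S * (\<Prod>i\<in>S. of_bool (x i)) = 0"
    proof
      fix S assume "S \<in> Pow V - {{}}"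
      then have "0 < card S"
        using assms(1) by (auto simp: card_gt_0_iff dest: finite_subset)
      then show "c S * (\<Prod>i\<in>S. of_bool (x i)) = 0"
        using assms(2) by (simp add: ml_degree_le_def)
    qed
  qed (use assms(1) in auto)
  then show ?thesis
    by simp
qed

lemma ml_eval_uminus: "ml_eval V (\<lambda>S. - c S) x = - ml_eval V c x"
  by (simp add: ml_eval_def sum_negf)

lemma ml_eval_diff: "ml_eval V (\<lambda>S. c S - c' S) x = ml_eval V c x - ml_eval V c' x"
  by (simp add: ml_eval_def sum_subtractf left_diff_distrib)

lemma ml_restrict_support:
  assumes "\<And>S. c S \<noteq> 0 \<Longrightarrow> S \<subseteq> V" "ml_restrict c A a S \<noteq> 0"
  shows "S \<subseteq> V - A"
proof -
  have SA: "S \<inter> A = {}"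
    using assms(2) by (auto simp: ml_restrict_def split: if_splits)
  have "\<exists>U. c (S \<union> U) \<noteq> 0"
    using assms(2) by (rule contrapos_np) (simp add: ml_restrict_def)
  then obtain U where "c (S \<union> U) \<noteq> 0" ..
  then show ?thesis
    using assms(1)[of "S \<union> U"] SA by blast
qed

text \<open>There are infinitely many inputs, but the value depends only on the bits in
  \<open>V\<close>, so a maximum over the finitely many subsets of \<open>V\<close>
  suffices.\<close>

lemma exists_max_abs_ml_eval:
  assumes "finite V"
  obtains x where "\<And>y. \<bar>ml_eval V c y\<bar> \<le> \<bar>ml_eval V c x\<bar>"
proof -
  let ?h = "\<lambda>X. \<bar>ml_eval V c (\<lambda>i. i \<in> X)\<bar>"
  obtain X where X: "\<And>Y. Y \<in> Pow V \<Longrightarrow> ?h Y \<le> ?h X"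
  proof -
    have "Max (?h ` Pow V) \<in> ?h ` Pow V"
      using assms by (intro Max_in) auto
    then obtain X where "Max (?h ` Pow V) = ?h X"
      by blast
    then show thesis
      using that assms by (metis Max_ge finite_Pow_iff finite_imageI imageI)
  qed
  have "\<bar>ml_eval V c y\<bar> \<le> ?h X" for y
  proof -
    have "ml_eval V c y = ml_eval V c (\<lambda>i. i \<in> {i \<in> V. y i})"
      by (rule ml_eval_cong) auto
    then show ?thesis
      using X[of "{i \<in> V. y i}"] by auto
  qed
  then show ?thesis
    using that by blast
qed

text \<open>Separate degree bounds \<open>a\<close> and \<open>b\<close> allow induction on
  \<open>a + b\<close>: each round lowers one of them by 1 at a cost of at most
  \<open>2 * s\<^sup>2 * r\<close> queries. All hypotheses persist under restriction, with
  \<open>s\<close> and \<open>r\<close> unchanged.\<close>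

lemma exists_dtree:
  assumes "finite V" "\<And>S. p S \<noteq> 0 \<Longrightarrow> S \<subseteq> V" "\<And>S. q S \<noteq> 0 \<Longrightarrow> S \<subseteq> V"
    and "ml_degree_le p a" "ml_degree_le q b" "ml_degree_le t s" "a \<le> r" "b \<le> r"
    and "\<And>x. ml_eval V p x \<noteq> 0 \<longleftrightarrow> f x" "\<And>x. ml_eval V q x \<noteq> 0 \<longleftrightarrow> \<not> f x"
    and "\<And>x. ml_eval V t x \<noteq> 0" "\<And>x. ml_eval V t x < 0 \<longleftrightarrow> f x"
  shows "\<exists>T. queries T \<subseteq> V \<and> depth T \<le> 2 * s\<^sup>2 * r * (a + b) \<and> (\<forall>x. run T x = f x)"
  using assms
proof (induction "a + b" arbitrary: V p q t f a b rule: less_induct)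
  case less
  note V = less.prems(1) and p = less.prems(4) and q = less.prems(5) and t = less.prems(6)
    and fp = less.prems(9) and fq = less.prems(10) and t0 = less.prems(11) and ft = less.prems(12)
  \<comment> \<open>One round: query all of \<open>A\<close>, then continue with the restricted
    polynomials for each outcome.\<close>
  have step: ?case
    if A: "A \<subseteq> V" "card A \<le> 2 * s\<^sup>2 * r" and ab: "a' + b' + 1 = a + b" "a' \<le> r" "b' \<le> r"
      and deg: "\<And>\<alpha>. ml_degree_le (ml_restrict p A \<alpha>) a'" "\<And>\<alpha>. ml_degree_le (ml_restrict q A \<alpha>) b'"
    for A a' b'
  proof -
    have finA: "finite A"
      using A(1) V finite_subset by blast
    have "\<exists>T. queries T \<subseteq> V \<and> depth T \<le> 2 * s\<^sup>2 * r * (a' + b') \<and>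
        (\<forall>x. True \<longrightarrow> (\<forall>i\<in>A. x i = \<alpha> i) \<longrightarrow> run T x = f x)" for \<alpha>
    proof -
      \<comment> \<open>The restricted polynomials represent \<open>f\<close> with the bits in
        \<open>A\<close> overwritten, which is \<open>f\<close> itself on inputs consistent with
        \<open>\<alpha>\<close>.\<close>
      have "\<exists>T. queries T \<subseteq> V - A \<and> depth T \<le> 2 * s\<^sup>2 * r * (a' + b') \<and>
          (\<forall>x. run T x = f (override_on x \<alpha> A))"
      proof (rule less.hyps[of _ _ _ "ml_restrict p A \<alpha>" "ml_restrict q A \<alpha>" "ml_restrict t A \<alpha>"])
        show "ml_degree_le (ml_restrict t A \<alpha>) s"
          by (rule ml_degree_le_restrict[OF t finA])
        show "S \<subseteq> V - A" if "ml_restrict p A \<alpha> S \<noteq> 0" for S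
          using ml_restrict_support[OF less.prems(2) that] .
        show "S \<subseteq> V - A" if "ml_restrict q A \<alpha> S \<noteq> 0" for S
          using ml_restrict_support[OF less.prems(3) that] .
      qed (use V ab deg in \<open>simp_all add: ml_eval_restrict[OF V A(1)] fp fq t0 ft\<close>)
      then obtain T where T: "queries T \<subseteq> V - A" "depth T \<le> 2 * s\<^sup>2 * r * (a' + b')"
        "\<And>x. run T x = f (override_on x \<alpha> A)"
        by blast
      moreover have "override_on x \<alpha> A = x" if "\<forall>i\<in>A. x i = \<alpha> i" for x
        using that by (auto simp: override_on_def)
      ultimately show ?thesis
        by (metis Diff_subset subset_trans)
    qed
    then have "\<exists>T. queries T \<subseteq> V \<and> depth T \<le> card A + 2 * s\<^sup>2 * r * (a' + b') \<and> (\<forall>x. True \<longrightarrow> run T x = f x)"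
      by (rule dtree_query_all[OF finA A(1)])
    then obtain T where "queries T \<subseteq> V" "depth T \<le> card A + 2 * s\<^sup>2 * r * (a' + b')" "\<And>x. run T x = f x"
      by blast
    moreover have "card A + 2 * s\<^sup>2 * r * (a' + b') \<le> 2 * s\<^sup>2 * r * (a + b)"
      using A(2) unfolding ab(1)[symmetric] by (simp add: algebra_simps)
    ultimately show ?thesis
      using le_trans by blast
  qed
  obtain x where max: "\<And>y. \<bar>ml_eval V t y\<bar> \<le> \<bar>ml_eval V t x\<bar>"
    using exists_max_abs_ml_eval[OF V, of t] by blast
  consider "a = 0" | "b = 0" | a' b' where "a = Suc a'" "b = Suc b'"
    by (metis not0_implies_Suc)
  then show ?case
  proof cases
    case 1
    then have "ml_eval V p x = p {}" for x
      using ml_eval_degree_0[OF V] p by blast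
    then show ?thesis
      using fp by (intro exI[of _ "Output (p {} \<noteq> 0)"]) auto
  next
    case 2
    then have "ml_eval V q x = q {}" for x
      using ml_eval_degree_0[OF V] q by blast
    then show ?thesis
      using fq by (intro exI[of _ "Output (q {} = 0)"]) auto
  next
    case 3
    show ?thesis
    proof (cases "f x")
      case False
      then have "0 < ml_eval V t x"
        using t0[of x] ft[of x] by linarith
      moreover have "\<bar>ml_eval V t y\<bar> \<le> ml_eval V t x" for y
        using max[of y] \<open>0 < ml_eval V t x\<close> by simp
      moreover have "ml_eval V t y \<le> 0" if "ml_eval V p y \<noteq> 0" for y
        using that fp[of y] ft[of y] by simp
      ultimately obtain A where A: "A \<subseteq> V" "card A \<le> 2 * s\<^sup>2 * a"
        "\<And>S. card S = a \<Longrightarrow> p S \<noteq> 0 \<Longrightarrow> S \<inter> A \<noteq> {}"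
        using exists_hitting_set[OF V less.prems(2) p _ t] 3 by blast
      have finA: "finite A"
        using A(1) V finite_subset by blast
      show ?thesis
      proof (rule step[of A a' b])
        show "card A \<le> 2 * s\<^sup>2 * r"
          using A(2) less.prems(7) by (meson le_trans mult_le_mono2)
        show "ml_degree_le (ml_restrict p A \<alpha>) a'" for \<alpha>
          using ml_degree_le_restrict_hitting[of p a' A \<alpha>] p A(3) finA 3 by blast
        show "ml_degree_le (ml_restrict q A \<alpha>) b" for \<alpha>
          by (rule ml_degree_le_restrict[OF q finA])
      qed (use A(1) 3 less.prems in auto)
    next
      case True
      \<comment> \<open>Negating \<open>t\<close> makes its extremal value positive, and
        \<open>q\<close>, nonzero only where \<open>f\<close> is 0, takes the place of
        \<open>p\<close>.\<close>
      let ?t = "\<lambda>S. - t S"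
      have "0 < ml_eval V ?t x"
        using True ft[of x] by (simp add: ml_eval_uminus)
      moreover have "\<bar>ml_eval V ?t y\<bar> \<le> ml_eval V ?t x" for y
        using max[of y] \<open>0 < ml_eval V ?t x\<close> by (simp add: ml_eval_uminus)
      moreover have "ml_eval V ?t y \<le> 0" if "ml_eval V q y \<noteq> 0" for y
        using that fq[of y] ft[of y] by (simp add: ml_eval_uminus)
      moreover have "ml_degree_le ?t s"
        using t by (simp add: ml_degree_le_def)
      ultimately obtain A where A: "A \<subseteq> V" "card A \<le> 2 * s\<^sup>2 * b"
        "\<And>S. card S = b \<Longrightarrow> q S \<noteq> 0 \<Longrightarrow> S \<inter> A \<noteq> {}"
        using exists_hitting_set[OF V less.prems(3) q] 3 by blast
      have finA: "finite A"
        using A(1) V finite_subset by blast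
      show ?thesis
      proof (rule step[of A a b'])
        show "card A \<le> 2 * s\<^sup>2 * r"
          using A(2) less.prems(8) by (meson le_trans mult_le_mono2)
        show "ml_degree_le (ml_restrict q A \<alpha>) b'" for \<alpha>
          using ml_degree_le_restrict_hitting[of q b' A \<alpha>] q A(3) finA 3 by blast
        show "ml_degree_le (ml_restrict p A \<alpha>) a" for \<alpha>
          by (rule ml_degree_le_restrict[OF p finA])
      qed (use A(1) 3 less.prems in auto)
    qed
  qed
qed

section \<open>Polynomials as functions on the cube\<close>

text \<open>On 0/1 inputs a monomial depends only on which variables occur in it, so coefficients
  are collected by variable set.\<close>

definition ml_coeff :: "real_mpoly \<Rightarrow> nat set \<Rightarrow> real" where
  "ml_coeff p S = (\<Sum>m\<in>{m \<in> Poly_Mapping.keys p. Poly_Mapping.keys m = S}. Poly_Mapping.lookup p m)"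

lemma monom_value_of_bool:
  "monom_value m (\<lambda>i. of_bool (x i)) = (\<Prod>i\<in>Poly_Mapping.keys m. of_bool (x i))"
  unfolding monom_value_def by (intro prod.cong) (auto simp: in_keys_iff)

lemma cube_value_eq_ml_eval:
  assumes "multilinear n p"
  shows "cube_value p x = ml_eval {..<n} (ml_coeff p) x"
proof -
  have "ml_eval {..<n} (ml_coeff p) x =
      (\<Sum>S\<in>Pow {..<n}. \<Sum>m\<in>{m \<in> Poly_Mapping.keys p. Poly_Mapping.keys m = S}.
        Poly_Mapping.lookup p m * monom_value m (\<lambda>i. of_bool (x i)))"
    unfolding ml_eval_def ml_coeff_def
    by (intro sum.cong refl) (simp add: sum_distrib_right monom_value_of_bool)
  also have "\<dots> = cube_value p x"
    unfolding cube_value_def poly_value_def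
    using assms by (intro sum.group) (auto simp: multilinear_def)
  finally show ?thesis
    by simp
qed

lemma ml_coeff_nonzeroE:
  assumes "ml_coeff p S \<noteq> 0"
  obtains m where "m \<in> Poly_Mapping.keys p" "Poly_Mapping.keys m = S"
  using assms unfolding ml_coeff_def by (auto elim: sum.not_neutral_contains_not_neutral)

lemma ml_coeff_support:
  assumes "multilinear n p" "ml_coeff p S \<noteq> 0"
  shows "S \<subseteq> {..<n}"
  using assms by (auto simp: multilinear_def elim!: ml_coeff_nonzeroE)

lemma ml_degree_le_ml_coeff: "ml_degree_le (ml_coeff p) (total_degree p)"
  unfolding ml_degree_le_def
proof (intro allI impI, rule ccontr)
  fix S assume S: "total_degree p < card S" "ml_coeff p S \<noteq> 0"
  then obtain m where m: "m \<in> Poly_Mapping.keys p" "Poly_Mapping.keys m = S"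
    by (elim ml_coeff_nonzeroE)
  have "card S = (\<Sum>i\<in>Poly_Mapping.keys m. 1)"
    by (simp add: m)
  also have "\<dots> \<le> monom_degree m"
    unfolding monom_degree_def by (intro sum_mono) (auto simp: in_keys_iff)
  also have "\<dots> \<le> total_degree p"
    unfolding total_degree_def using m by (intro Max_ge) auto
  finally show False
    using S by simp
qed

text \<open>Induction on the variables, using \<open>h = h0 + x j * (h1 - h0)\<close> for the two
  functions \<open>h0\<close> and \<open>h1\<close> obtained by fixing bit \<open>j\<close>.\<close>

lemma exists_ml_interpolation:
  assumes "finite V"
  shows "\<exists>c. \<forall>x. ml_eval V c x = g {i \<in> V. x i}"
  using assms
proof (induction V arbitrary: g rule: finite_induct)
  case empty
  show ?case
    by (intro exI[of _ g]) (simp add: ml_eval_def)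
next
  case (insert j V)
  obtain c0 where c0: "\<And>x. ml_eval V c0 x = g {i \<in> V. x i}"
    using insert.IH[of g] by blast
  obtain c1 where c1: "\<And>x. ml_eval V c1 x = g (insert j {i \<in> V. x i})"
    using insert.IH[of "\<lambda>X. g (insert j X)"] by blast
  define c where "c S = (if j \<in> S then c1 (S - {j}) - c0 (S - {j}) else c0 S)" for S
  have inj: "inj_on (insert j) (Pow V)"
    using insert.hyps by (intro inj_onI) (metis PowD insert_ident subsetD)
  have "ml_eval (insert j V) c x = g {i \<in> insert j V. x i}" for x
  proof -
    have "ml_eval (insert j V) c x = (\<Sum>S\<in>Pow V. c S * (\<Prod>i\<in>S. of_bool (x i))) +
        (\<Sum>S\<in>Pow V. c (insert j S) * (\<Prod>i\<in>insert j S. of_bool (x i)))"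
      unfolding ml_eval_def Pow_insert
      using insert.hyps by (subst sum.union_disjoint) (auto simp: sum.reindex[OF inj])
    also have "(\<Sum>S\<in>Pow V. c S * (\<Prod>i\<in>S. of_bool (x i))) = ml_eval V c0 x"
      unfolding ml_eval_def using insert.hyps by (intro sum.cong) (auto simp: c_def)
    also have "(\<Sum>S\<in>Pow V. c (insert j S) * (\<Prod>i\<in>insert j S. of_bool (x i))) =
        of_bool (x j) * ml_eval V (\<lambda>S. c1 S - c0 S) x"
      unfolding ml_eval_def sum_distrib_left
    proof (rule sum.cong[OF refl])
      fix S assume "S \<in> Pow V"
      then have "finite S" "j \<notin> S"
        using insert.hyps by (auto intro: finite_subset)
      then show "c (insert j S) * (\<Prod>i\<in>insert j S. of_bool (x i)) =
          of_bool (x j) * ((c1 S - c0 S) * (\<Prod>i\<in>S. of_bool (x i)))"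
        by (simp add: c_def)
    qed
    finally have eq: "ml_eval (insert j V) c x = ml_eval V c0 x + of_bool (x j) * (ml_eval V c1 x - ml_eval V c0 x)"
      by (simp add: ml_eval_diff)
    have "{i \<in> insert j V. x i} = (if x j then insert j {i \<in> V. x i} else {i \<in> V. x i})"
      by auto
    then show ?thesis
      unfolding eq c0 c1 by simp
  qed
  then show ?case
    by blast
qed

lemma exists_multilinear_with_coeffs:
  obtains p where "multilinear n p" "\<And>x. cube_value p x = ml_eval {..<n} c x"
proof -
  \<comment> \<open>The cutoff at \<open>n\<close> gives every exponent vector finite support, even
    for infinite \<open>S\<close>.\<close>
  define mon :: "nat set \<Rightarrow> monom" where
    "mon S = Abs_poly_mapping (\<lambda>i. of_bool (i \<in> S \<and> i < n))" for S
  have lookup_mon: "Poly_Mapping.lookup (mon S) = (\<lambda>i. of_bool (i \<in> S \<and> i < n))" for S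
    unfolding mon_def by (subst lookup_Abs_poly_mapping) (auto intro: finite_subset[of _ "{..<n}"])
  have keys_mon: "Poly_Mapping.keys (mon S) = S" if "S \<in> Pow {..<n}" for S
    using that by (auto simp: in_keys_iff lookup_mon)
  define p :: real_mpoly where
    "p = Abs_poly_mapping (\<lambda>m. if m \<in> mon ` Pow {..<n} then c (Poly_Mapping.keys m) else 0)"
  have lookup_p: "Poly_Mapping.lookup p = (\<lambda>m. if m \<in> mon ` Pow {..<n} then c (Poly_Mapping.keys m) else 0)"
    unfolding p_def by (subst lookup_Abs_poly_mapping) (auto intro: finite_subset[of _ "mon ` Pow {..<n}"])
  have keys_p: "Poly_Mapping.keys p \<subseteq> mon ` Pow {..<n}"
    by (auto simp: in_keys_iff lookup_p split: if_splits)
  have "multilinear n p"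
    unfolding multilinear_def
  proof
    fix m assume "m \<in> Poly_Mapping.keys p"
    then obtain S where "S \<in> Pow {..<n}" "m = mon S"
      using keys_p by blast
    then show "Poly_Mapping.keys m \<subseteq> {..<n} \<and> (\<forall>i. Poly_Mapping.lookup m i \<le> 1)"
      using keys_mon[of S] by (auto simp: lookup_mon)
  qed
  moreover have "cube_value p x = ml_eval {..<n} c x" for x
  proof -
    have inj: "inj_on mon (Pow {..<n})"
      by (rule inj_onI) (metis keys_mon)
    have "cube_value p x = (\<Sum>m\<in>mon ` Pow {..<n}. Poly_Mapping.lookup p m * monom_value m (\<lambda>i. of_bool (x i)))"
      unfolding cube_value_def poly_value_def using keys_p
      by (intro sum.mono_neutral_left) (auto simp: in_keys_iff)
    also have "\<dots> = ml_eval {..<n} c x"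
      unfolding ml_eval_def sum.reindex[OF inj]
      by (intro sum.cong refl) (simp add: lookup_p monom_value_of_bool keys_mon)
    finally show ?thesis .
  qed
  ultimately show ?thesis
    using that by blast
qed

lemma exists_multilinear_interpolation:
  obtains p where "multilinear n p" "\<And>x. x \<in> cube n \<Longrightarrow> cube_value p x = g x"
proof -
  obtain c where c: "\<And>x. ml_eval {..<n} c x = g (\<lambda>i\<in>{..<n}. i \<in> {i \<in> {..<n}. x i})"
    using exists_ml_interpolation[of "{..<n}" "\<lambda>X. g (\<lambda>i\<in>{..<n}. i \<in> X)"] by blast
  obtain p where p: "multilinear n p" "\<And>x. cube_value p x = ml_eval {..<n} c x"
    using exists_multilinear_with_coeffs[of n c] by blast
  have "(\<lambda>i\<in>{..<n}. i \<in> {i \<in> {..<n}. x i}) = x" if "x \<in> cube n" for x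
    using that unfolding cube_def by (intro ext) (auto simp: restrict_def PiE_def extensional_def)
  then show ?thesis
    using that p c by simp
qed

text \<open>Without a representation, the \<open>LEAST\<close> in the definitions of \<open>rdeg\<close> and \<open>sdeg\<close> would be unspecified.\<close>

lemma rdeg_attained:
  obtains p q where "rational_rep n f p q" "rdeg n f = max (total_degree p) (total_degree q)"
proof -
  obtain p where p: "multilinear n p" "\<And>x. x \<in> cube n \<Longrightarrow> cube_value p x = of_bool (f x)"
    using exists_multilinear_interpolation[of n "\<lambda>x. of_bool (f x)"] by blast
  obtain q where q: "multilinear n q" "\<And>x. x \<in> cube n \<Longrightarrow> cube_value q x = 1"
    using exists_multilinear_interpolation[of n "\<lambda>_. 1"] by blast
  have "rational_rep n f p q"
    using p q by (simp add: rational_rep_def)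
  then have "\<exists>d p q. rational_rep n f p q \<and> d = max (total_degree p) (total_degree q)"
    by blast
  then have "\<exists>p q. rational_rep n f p q \<and> rdeg n f = max (total_degree p) (total_degree q)"
    unfolding rdeg_def by (rule LeastI_ex)
  then show ?thesis
    using that by blast
qed

lemma sdeg_attained:
  obtains p where "sign_rep n f p" "sdeg n f = total_degree p"
proof -
  obtain p where p: "multilinear n p" "\<And>x. x \<in> cube n \<Longrightarrow> cube_value p x = (if f x then - 1 else 1)"
    using exists_multilinear_interpolation[of n "\<lambda>x. if f x then - 1 else 1"] by blast
  have "sign_rep n f p"
    using p by (simp add: sign_rep_def)
  then have "\<exists>d p. sign_rep n f p \<and> d = total_degree p"
    by blast
  then have "\<exists>p. sign_rep n f p \<and> sdeg n f = total_degree p"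
    unfolding sdeg_def by (rule LeastI_ex)
  then show ?thesis
    using that by blast
qed

theorem theorem3p5:
  fixes n :: nat and f :: "(nat \<Rightarrow> bool) \<Rightarrow> bool"
  shows "dt_complexity n f \<le> 4 * (sdeg n f)\<^sup>2 * (rdeg n f)\<^sup>2"
proof -
  let ?V = "{..<n}"
  let ?r = "rdeg n f"
  obtain p q where pq: "rational_rep n f p q" and r: "?r = max (total_degree p) (total_degree q)"
    using rdeg_attained .
  obtain t where t: "sign_rep n f t" and s: "sdeg n f = total_degree t"
    using sdeg_attained .
  \<comment> \<open>The tree construction speaks of all inputs, whereas the representations are
    constrained only on the cube; \<open>g\<close> ignores the bits outside it.\<close>
  define g where "g x = f (restrict x ?V)" for x
  \<comment> \<open>Since \<open>p = q\<close> where \<open>f\<close> is 1 and \<open>p = 0\<close>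
    where \<open>f\<close> is 0, the difference \<open>q - p\<close> is nonzero exactly on the zeros
    of \<open>f\<close>.\<close>
  define q' where "q' S = ml_coeff q S - ml_coeff p S" for S
  have ml: "multilinear n p" "multilinear n q" "multilinear n t"
    using pq t by (auto simp: rational_rep_def sign_rep_def)
  have cube: "restrict x ?V \<in> cube n" for x
    by (simp add: cube_def)
  have eval: "ml_eval ?V (ml_coeff u) x = cube_value u (restrict x ?V)" if "multilinear n u" for u x
    unfolding cube_value_eq_ml_eval[OF that] by (rule ml_eval_cong) simp
  have q': "ml_eval ?V q' x = cube_value q (restrict x ?V) - cube_value p (restrict x ?V)" for x
    unfolding q'_def using ml by (simp add: ml_eval_diff eval)
  have rep: "cube_value q (restrict x ?V) \<noteq> 0"
    "cube_value p (restrict x ?V) = (if g x then cube_value q (restrict x ?V) else 0)" for x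
    using pq cube[of x] unfolding rational_rep_def g_def by (auto simp: divide_eq_eq split: if_splits)
  \<comment> \<open>Both \<open>p\<close> and \<open>q - p\<close> have degree at most
    \<open>?r\<close>, so the two degree bounds sum to \<open>?r + ?r\<close>, which yields the
    constant 4.\<close>
  have "\<exists>T. queries T \<subseteq> ?V \<and> depth T \<le> 2 * (sdeg n f)\<^sup>2 * ?r * (?r + ?r) \<and> (\<forall>x. run T x = g x)"
  proof (rule exists_dtree[where p = "ml_coeff p" and q = q' and t = "ml_coeff t"])
    have *: "ml_degree_le (ml_coeff p) ?r" "ml_degree_le (ml_coeff q) ?r"
      using ml_degree_le_ml_coeff[of p] ml_degree_le_ml_coeff[of q] r by (auto simp: ml_degree_le_def)
    then show "ml_degree_le (ml_coeff p) ?r" "ml_degree_le q' ?r"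
      by (auto simp: ml_degree_le_def q'_def)
    show "ml_degree_le (ml_coeff t) (sdeg n f)"
      unfolding s by (rule ml_degree_le_ml_coeff)
    show "S \<subseteq> ?V" if "ml_coeff p S \<noteq> 0" for S
      using ml_coeff_support[OF ml(1) that] .
    show "S \<subseteq> ?V" if "q' S \<noteq> 0" for S
      using that ml_coeff_support[OF ml(1), of S] ml_coeff_support[OF ml(2), of S]
      by (cases "ml_coeff p S = 0") (simp_all add: q'_def)
    show "ml_eval ?V (ml_coeff p) x \<noteq> 0 \<longleftrightarrow> g x" for x
      using rep[of x] by (simp add: eval ml)
    show "ml_eval ?V q' x \<noteq> 0 \<longleftrightarrow> \<not> g x" for x
      using rep[of x] by (simp add: q')
    show "ml_eval ?V (ml_coeff t) x \<noteq> 0" "ml_eval ?V (ml_coeff t) x < 0 \<longleftrightarrow> g x" for x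
      using t cube[of x] by (auto simp: eval ml sign_rep_def g_def)
  qed auto
  then obtain T where T: "queries T \<subseteq> ?V" "depth T \<le> 2 * (sdeg n f)\<^sup>2 * ?r * (?r + ?r)" "\<And>x. run T x = g x"
    by blast
  have "restrict x ?V = x" if "x \<in> cube n" for x
    using that unfolding cube_def by (rule PiE_restrict)
  then have "computes n T f"
    using T by (simp add: computes_def g_def)
  then have "dt_complexity n f \<le> depth T"
    unfolding dt_complexity_def by (intro Least_le) blast
  also note T(2)
  finally show ?thesis
    by (simp add: power2_eq_square algebra_simps)
qed

end
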